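(* Let $y>0$ be a real number. If $x>1$, then $$\frac{[\Gamma(x+y+1)/\Gamma(y+1)]^{1/x}}{[\Gamma(x+y+2)/\Gamma(y+1)]^{1/(x+1)}} < \sqrt{\frac{x+y}{x+y+1}}.$$ If $0<x<1$, then the inequality is reversed, i.e. $$\frac{[\Gamma(x+y+1)/\Gamma(y+1)]^{1/x}}{[\Gamma(x+y+2)/\Gamma(y+1)]^{1/(x+1)}} > \sqrt{\frac{x+y}{x+y+1}}.$$
   Context: $\Gamma$ denotes Euler's gamma function, $\Gamma(z)=\int_0^\infty u^{z-1}e^{-u}\,du$ for $z>0$. The variables $x,y$ are real. *)

theory Defs
  imports "HOL-Analysis.Analysis"
begin

end

theory Submission
  imports Defs "HOL-Real_Asymp.Real_Asymp"
begin

text \<open>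
  Write \<open>g = ln (\<Gamma>(x + y + 1) / \<Gamma>(y + 1))\<close>. Since \<open>\<Gamma>(x + y + 2) = (x + y + 1) \<Gamma>(x + y + 1)\<close>, the logarithm
  of the left-hand side minus that of the right-hand side involves only \<open>g\<close> and the logarithms of
  \<open>x + y\<close> and \<open>x + y + 1\<close>; multiplied by \<open>-x (x + 1)\<close> it is
  \[ F(y) = \frac{x(x+1)}{2} \ln(x+y) - \frac{x(x-1)}{2} \ln(x+y+1) - g, \]
  so both claims together say that \<open>F(y)\<close> has the sign of \<open>x - 1\<close>.

  This follows by telescoping along \<open>y, y + 1, y + 2, \<dots>\<close>. In the difference \<open>F(y) - F(y + 1)\<close> the Gamma
  function cancels and a combination of four logarithms remains. It tends to \<open>0\<close> as
  \<open>y \<rightarrow> \<infinity>\<close>, and its derivative in \<open>y\<close> collapses to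
  \[ -\frac{x(x-1)(x+1)}{(y+1)(x+y)(x+y+1)(x+y+2)}, \]
  so the difference has the sign of \<open>x - 1\<close> for every \<open>y\<close>. Finally
  \<open>F(y + n) \<rightarrow> 0\<close>, which is the asymptotics \<open>\<Gamma>(y + n + x + 1) / \<Gamma>(y + n + 1) \<sim> n\<^sup>x\<close> that Euler's
  limit for \<open>\<Gamma>\<close> provides.
\<close>

text \<open>The function \<open>F\<close>: the factor \<open>-x (x + 1)\<close> clears the exponents \<open>1 / x\<close> and \<open>1 / (x + 1)\<close>.\<close>

definition log_gap :: "real \<Rightarrow> real \<Rightarrow> real" where
  "log_gap x y = x * (x + 1) / 2 * ln (x + y) - x * (x - 1) / 2 * ln (x + y + 1)
     - (ln (Gamma (x + y + 1)) - ln (Gamma (y + 1)))"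

text \<open>The difference of \<open>log_gap x\<close> at \<open>y\<close> and at \<open>y + 1\<close>, freed of the Gamma function.\<close>

definition log_gap_step :: "real \<Rightarrow> real \<Rightarrow> real" where
  "log_gap_step x y = x * (x + 1) / 2 * ln (x + y) + (1 - x\<^sup>2) * ln (x + y + 1)
     + x * (x - 1) / 2 * ln (x + y + 2) - ln (y + 1)"

lemma ln_Gamma_plus1:
  fixes z :: real
  assumes "z > 0"
  shows "ln (Gamma (z + 1)) = ln z + ln (Gamma z)"
proof -
  have "z \<notin> \<int>\<^sub>\<le>\<^sub>0"
    using assms by (auto elim!: nonpos_Ints_cases)
  hence "Gamma (z + 1) = z * Gamma z"
    by (rule Gamma_plus1)
  moreover have "ln (z * Gamma z) = ln z + ln (Gamma z)"
    using assms by (intro ln_mult_pos Gamma_real_pos)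
  ultimately show ?thesis by simp
qed

lemma log_gap_telescope:
  assumes "x > 0" "y > 0"
  shows "log_gap x y = log_gap_step x y + log_gap x (y + 1)"
proof -
  have "ln (Gamma (x + y + 2)) = ln (x + y + 1) + ln (Gamma (x + y + 1))"
    using ln_Gamma_plus1[of "x + y + 1"] assms by (simp add: add_ac)
  moreover have "ln (Gamma (y + 2)) = ln (y + 1) + ln (Gamma (y + 1))"
    using ln_Gamma_plus1[of "y + 1"] assms by (simp add: add_ac)
  moreover have "x + (y + 1) = x + y + 1" "x + y + 1 + 1 = x + y + 2" "y + 1 + 1 = y + 2"
    by simp_all
  moreover define A B where "A = x * (x + 1) / 2" and "B = x * (x - 1) / 2"
  moreover have "x\<^sup>2 = A + B"
    unfolding A_def B_def by (simp add: power2_eq_square field_simps)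
  ultimately show ?thesis
    unfolding log_gap_def log_gap_step_def A_def[symmetric] B_def[symmetric]
    by (simp add: algebra_simps)
qed

text \<open>
  The derivative is a sum \<open>\<Sum> c\<^sub>i / (s - a\<^sub>i)\<close> in \<open>s = x + t + 1\<close>, with \<open>a\<^sub>i\<close> ranging over \<open>1, 0, -1, x\<close>.
  Its expansion in powers of \<open>1 / s\<close> has the moments \<open>\<Sum> c\<^sub>i a\<^sub>i\<^sup>k\<close> as coefficients. These vanish for
  \<open>k = 0, 1, 2\<close>, so over the common denominator of degree \<open>4\<close> the numerator is a constant: the third
  moment \<open>x - x\<^sup>3\<close>.
\<close>

lemma DERIV_log_gap_step:
  assumes "x > 0" "t > 0"
  shows "(log_gap_step x has_real_derivative
      - (x * (x - 1) * (x + 1) / ((t + 1) * (x + t) * (x + t + 1) * (x + t + 2)))) (at t)"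
proof -
  have "(log_gap_step x has_real_derivative
      x * (x + 1) / 2 * (1 / (x + t)) + (1 - x\<^sup>2) * (1 / (x + t + 1))
      + x * (x - 1) / 2 * (1 / (x + t + 2)) - 1 / (t + 1)) (at t)"
  proof -
    have "((\<lambda>t. ln (x + t)) has_real_derivative 1 / (x + t)) (at t)"
         "((\<lambda>t. ln (x + t + 1)) has_real_derivative 1 / (x + t + 1)) (at t)"
         "((\<lambda>t. ln (x + t + 2)) has_real_derivative 1 / (x + t + 2)) (at t)"
         "((\<lambda>t. ln (t + 1)) has_real_derivative 1 / (t + 1)) (at t)"
      using assms by (auto intro!: derivative_eq_intros)
    thus ?thesis
      unfolding log_gap_step_def[abs_def] by (intro DERIV_add DERIV_diff DERIV_cmult)
  qed
  also have "x * (x + 1) / 2 * (1 / (x + t)) + (1 - x\<^sup>2) * (1 / (x + t + 1))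
      + x * (x - 1) / 2 * (1 / (x + t + 2)) - 1 / (t + 1) =
      - (x * (x - 1) * (x + 1) / ((t + 1) * (x + t) * (x + t + 1) * (x + t + 2)))"
  proof -
    define D where "D = (t + 1) * (x + t) * (x + t + 1) * (x + t + 2)"
    have "1 / (x + t) = (t + 1) * (x + t + 1) * (x + t + 2) / D"
         "1 / (x + t + 1) = (t + 1) * (x + t) * (x + t + 2) / D"
         "1 / (x + t + 2) = (t + 1) * (x + t) * (x + t + 1) / D"
         "1 / (t + 1) = (x + t) * (x + t + 1) * (x + t + 2) / D"
      using assms by (simp_all add: D_def)
    hence "x * (x + 1) / 2 * (1 / (x + t)) + (1 - x\<^sup>2) * (1 / (x + t + 1))
          + x * (x - 1) / 2 * (1 / (x + t + 2)) - 1 / (t + 1) =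
        (x * (x + 1) / 2 * ((t + 1) * (x + t + 1) * (x + t + 2))
          + (1 - x\<^sup>2) * ((t + 1) * (x + t) * (x + t + 2))
          + x * (x - 1) / 2 * ((t + 1) * (x + t) * (x + t + 1))
          - (x + t) * (x + t + 1) * (x + t + 2)) / D"
      by (simp only: times_divide_eq_right add_divide_distrib diff_divide_distrib)
    also have "x * (x + 1) / 2 * ((t + 1) * (x + t + 1) * (x + t + 2))
          + (1 - x\<^sup>2) * ((t + 1) * (x + t) * (x + t + 2))
          + x * (x - 1) / 2 * ((t + 1) * (x + t) * (x + t + 1))
          - (x + t) * (x + t + 1) * (x + t + 2) = - (x * (x - 1) * (x + 1))"
      by (simp add: field_simps power2_eq_square)
    finally show ?thesis
      by (simp add: D_def)
  qed
  finally show ?thesis .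
qed

text \<open>The coefficients of the four logarithms add up to \<open>0\<close>, so each \<open>ln\<close> may be compared with \<open>ln (t + 1)\<close>.\<close>

lemma log_gap_step_tendsto_0: "(log_gap_step x \<longlongrightarrow> 0) at_top"
proof -
  have eq: "log_gap_step x t = x * (x + 1) / 2 * (ln (x + t) - ln (t + 1))
      + (1 - x\<^sup>2) * (ln (x + t + 1) - ln (t + 1))
      + x * (x - 1) / 2 * (ln (x + t + 2) - ln (t + 1))" for t
    unfolding log_gap_step_def by (simp add: field_simps power2_eq_square)
  have "((\<lambda>t. ln (x + t) - ln (t + 1)) \<longlongrightarrow> 0) at_top"
       "((\<lambda>t. ln (x + t + 1) - ln (t + 1)) \<longlongrightarrow> 0) at_top"
       "((\<lambda>t. ln (x + t + 2) - ln (t + 1)) \<longlongrightarrow> 0) at_top"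
    by real_asymp+
  hence "(log_gap_step x \<longlongrightarrow> x * (x + 1) / 2 * 0 + (1 - x\<^sup>2) * 0 + x * (x - 1) / 2 * 0) at_top"
    unfolding eq[abs_def] by (intro tendsto_intros)
  thus ?thesis by simp
qed

text \<open>
  Multiplying by \<open>x - 1\<close> treats \<open>x > 1\<close> and \<open>x < 1\<close> at once: the product is strictly decreasing with
  limit \<open>0\<close>.
\<close>

lemma log_gap_step_sign:
  assumes "x > 0" "x \<noteq> 1" "y > 0"
  shows "0 < (x - 1) * log_gap_step x y"
proof (rule DERIV_neg_imp_decreasing_at_top[where f = "\<lambda>t. (x - 1) * log_gap_step x t"])
  show "((\<lambda>t. (x - 1) * log_gap_step x t) \<longlongrightarrow> 0) at_top"
    using tendsto_mult[OF tendsto_const log_gap_step_tendsto_0, of "x - 1" x] by simp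
next
  fix t assume "y \<le> t"
  with assms have t: "t > 0" by simp
  define d where "d = x * (x - 1) * (x + 1) / ((t + 1) * (x + t) * (x + t + 1) * (x + t + 2))"
  have "((\<lambda>t. (x - 1) * log_gap_step x t) has_real_derivative (x - 1) * (- d)) (at t)"
    unfolding d_def by (intro DERIV_cmult DERIV_log_gap_step assms t)
  moreover have "(x - 1) * d > 0"
  proof -
    have "(x - 1) * d =
        (x - 1)\<^sup>2 * (x * (x + 1) / ((t + 1) * (x + t) * (x + t + 1) * (x + t + 2)))"
      unfolding d_def by (simp add: power2_eq_square mult_ac)
    also have "\<dots> > 0"
      using assms t by (intro mult_pos_pos divide_pos_pos) auto
    finally show ?thesis .
  qed
  ultimately show "\<exists>d'. ((\<lambda>t. (x - 1) * log_gap_step x t) has_real_derivative d') (at t) \<and> d' < 0"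
    by (intro exI[of _ "(x - 1) * (- d)"]) simp
qed

text \<open>
  Euler's limit \<open>\<Gamma>(z) = lim n! n\<^sup>z / (z (z + 1) \<cdots> (z + n))\<close> in logarithmic form: the denominator is
  \<open>\<Gamma>(z + n + 1) / \<Gamma>(z)\<close>.
\<close>

lemma ln_Gamma_shift_asymp:
  fixes z :: real
  assumes "z > 0"
  shows "(\<lambda>n. ln (Gamma (z + real n + 1)) - z * ln (real n) - ln (fact n)) \<longlonglongrightarrow> 0"
proof -
  have nonpole: "z \<notin> \<int>\<^sub>\<le>\<^sub>0"
    using assms by (auto elim!: nonpos_Ints_cases)
  have pos: "Gamma z > 0"
    using assms by simp
  have "(\<lambda>n. ln (Gamma z) - ln (Gamma_series z n)) \<longlonglongrightarrow> ln (Gamma z) - ln (Gamma z)"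
    using pos by (intro tendsto_intros) auto
  moreover have "ln (Gamma z) - ln (Gamma_series z n) =
      ln (Gamma (z + real n + 1)) - z * ln (real n) - ln (fact n)" for n
  proof -
    have "Gamma (z + real n + 1) > 0"
      using assms by simp
    moreover have "pochhammer z (Suc n) = Gamma (z + real n + 1) / Gamma z"
      using pochhammer_Gamma[OF nonpole, of "Suc n"] by (simp add: add_ac)
    ultimately show ?thesis
      using pos unfolding Gamma_series_def by (simp add: ln_div ln_mult)
  qed
  ultimately show ?thesis by simp
qed

text \<open>
  The shift asymptotics at \<open>x + y\<close> and at \<open>y\<close> turn the Gamma quotient into \<open>x ln n\<close>, which is what the
  two weighted logarithms contribute because \<open>x (x + 1) / 2 - x (x - 1) / 2 = x\<close>.
\<close>

lemma log_gap_shift_tendsto_0: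
  assumes "x > 0" "y > 0"
  shows "(\<lambda>n. log_gap x (y + real n)) \<longlonglongrightarrow> 0"
proof -
  define E where "E z n = ln (Gamma (z + real n + 1)) - z * ln (real n) - ln (fact n)" for z n
  have eq: "log_gap x (y + real n) = x * (x + 1) / 2 * (ln (x + y + real n) - ln (real n))
      - x * (x - 1) / 2 * (ln (x + y + real n + 1) - ln (real n)) - (E (x + y) n - E y n)" for n
    unfolding log_gap_def E_def by (simp add: field_simps)
  have "(\<lambda>n. ln (x + y + real n) - ln (real n)) \<longlonglongrightarrow> 0"
       "(\<lambda>n. ln (x + y + real n + 1) - ln (real n)) \<longlonglongrightarrow> 0"
    by real_asymp+
  moreover have "E (x + y) \<longlonglongrightarrow> 0" "E y \<longlonglongrightarrow> 0"
    unfolding E_def[abs_def] using assms by (intro ln_Gamma_shift_asymp; simp)+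
  ultimately have "(\<lambda>n. log_gap x (y + real n)) \<longlonglongrightarrow>
      x * (x + 1) / 2 * 0 - x * (x - 1) / 2 * 0 - (0 - 0)"
    unfolding eq[abs_def] by (intro tendsto_intros)
  thus ?thesis by simp
qed

lemma log_gap_sign:
  assumes "x > 0" "x \<noteq> 1" "y > 0"
  shows "0 < (x - 1) * log_gap x y"
proof -
  have decr: "(x - 1) * log_gap x (t + 1) < (x - 1) * log_gap x t" if "t > 0" for t
    using log_gap_step_sign[OF assms(1,2) that] log_gap_telescope[OF assms(1) that]
    by (simp add: algebra_simps)
  \<comment> \<open>Starting the sequence at \<open>y + 1\<close> leaves one strict step, from \<open>y\<close> to \<open>y + 1\<close>, in reserve.\<close>
  have "decseq (\<lambda>n. (x - 1) * log_gap x (y + 1 + real n))"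
  proof (rule decseq_SucI)
    fix n
    show "(x - 1) * log_gap x (y + 1 + real (Suc n)) \<le> (x - 1) * log_gap x (y + 1 + real n)"
      using decr[of "y + 1 + real n"] assms(3) by (simp add: add_ac)
  qed
  moreover have "(\<lambda>n. (x - 1) * log_gap x (y + 1 + real n)) \<longlonglongrightarrow> (x - 1) * 0"
    using assms by (intro tendsto_intros log_gap_shift_tendsto_0) auto
  ultimately have "(x - 1) * 0 \<le> (x - 1) * log_gap x (y + 1 + real 0)"
    by (rule decseq_ge)
  with decr[OF assms(3)] show ?thesis by simp
qed

lemma Gamma_quotient_eq_sqrt_mult_exp:
  assumes "x > 0" "y > 0"
  shows "(Gamma (x + y + 1) / Gamma (y + 1)) powr (1 / x)
           / (Gamma (x + y + 2) / Gamma (y + 1)) powr (1 / (x + 1))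
         = sqrt ((x + y) / (x + y + 1)) * exp (- log_gap x y / (x * (x + 1)))"
proof -
  define g where "g = ln (Gamma (x + y + 1)) - ln (Gamma (y + 1))"
  define l where "l = ln (x + y)"
  define L where "L = ln (x + y + 1)"
  have pos: "Gamma (x + y + 1) > 0" "Gamma (x + y + 2) > 0" "Gamma (y + 1) > 0"
    using assms by simp_all
  have "ln (Gamma (x + y + 2)) = L + ln (Gamma (x + y + 1))"
    using ln_Gamma_plus1[of "x + y + 1"] assms by (simp add: L_def add_ac)
  hence "(Gamma (x + y + 1) / Gamma (y + 1)) powr (1 / x)
           / (Gamma (x + y + 2) / Gamma (y + 1)) powr (1 / (x + 1))
         = exp (g / x - (g + L) / (x + 1))"
    using pos by (simp add: powr_def ln_div exp_diff g_def)
  also have "g / x - (g + L) / (x + 1) = (l - L) / 2 + (- log_gap x y / (x * (x + 1)))"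
  proof -
    have "log_gap x y = x * (x + 1) / 2 * l - x * (x - 1) / 2 * L - g"
      by (simp add: log_gap_def g_def l_def L_def)
    moreover have "x + 1 \<noteq> 0" "x \<noteq> 0"
      using assms by simp_all
    ultimately show ?thesis
      by (simp add: divide_simps) (simp add: algebra_simps)
  qed
  also have "exp ((l - L) / 2 + (- log_gap x y / (x * (x + 1))))
      = exp ((l - L) / 2) * exp (- log_gap x y / (x * (x + 1)))"
    by (rule exp_add)
  also have "exp ((l - L) / 2) = sqrt ((x + y) / (x + y + 1))"
    using assms by (simp add: powr_half_sqrt[symmetric] powr_def ln_div l_def L_def)
  finally show ?thesis .
qed

theorem theorem1:
  fixes x y :: real
  assumes "y > 0"
  shows "(x > 1 \<longrightarrow>
           (Gamma (x + y + 1) / Gamma (y + 1)) powr (1 / x)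
             / (Gamma (x + y + 2) / Gamma (y + 1)) powr (1 / (x + 1))
           < sqrt ((x + y) / (x + y + 1)))
       \<and> (0 < x \<and> x < 1 \<longrightarrow>
           (Gamma (x + y + 1) / Gamma (y + 1)) powr (1 / x)
             / (Gamma (x + y + 2) / Gamma (y + 1)) powr (1 / (x + 1))
           > sqrt ((x + y) / (x + y + 1)))"
proof (intro conjI impI)
  assume x: "x > 1"
  have "log_gap x y > 0"
    using log_gap_sign[of x y] x assms by (simp add: zero_less_mult_iff)
  hence "exp (- log_gap x y / (x * (x + 1))) < 1"
    using x by simp
  moreover have "sqrt ((x + y) / (x + y + 1)) > 0"
    using x assms by simp
  ultimately show "(Gamma (x + y + 1) / Gamma (y + 1)) powr (1 / x)
      / (Gamma (x + y + 2) / Gamma (y + 1)) powr (1 / (x + 1)) < sqrt ((x + y) / (x + y + 1))"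
    using x assms by (subst Gamma_quotient_eq_sqrt_mult_exp) simp_all
next
  assume x: "0 < x \<and> x < 1"
  have "log_gap x y < 0"
    using log_gap_sign[of x y] x assms by (simp add: zero_less_mult_iff)
  hence "exp (- log_gap x y / (x * (x + 1))) > 1"
    using x by (simp add: divide_neg_pos)
  moreover have "sqrt ((x + y) / (x + y + 1)) > 0"
    using x assms by simp
  ultimately show "(Gamma (x + y + 1) / Gamma (y + 1)) powr (1 / x)
      / (Gamma (x + y + 2) / Gamma (y + 1)) powr (1 / (x + 1)) > sqrt ((x + y) / (x + y + 1))"
    using x assms by (subst Gamma_quotient_eq_sqrt_mult_exp) simp_all
qed

end
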